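(* For $h > 0$, $\theta \in \mathbb{R}$ and a polynomial $P$, let $$T_{\theta,h}(P)(x) = \frac{e^{i\theta} P(x+ih) - e^{-i\theta} P(x-ih)}{i}.$$ For every hyperbolic polynomial $P$ of degree $n \ge 2$, every $\theta \in \mathbb{R}$ with $\sin\theta \neq 0$, and every $h > 0$, $$\operatorname{mesh}(T_{\theta,h}(P)) \ge \operatorname{mesh}(T_{\theta,h}(x^n)).$$ For every $\theta \in \mathbb{R}$ with $\sin\theta = 0$, every $h>0$, and every hyperbolic polynomial $P$ of degree $n \ge 3$, the same inequality holds.
   Context: A real polynomial is called hyperbolic if all its zeros are real or if it is identically zero. The operator $T_{\theta,h}$ maps hyperbolic polynomials to hyperbolic polynomials. For a hyperbolic polynomial $R(x) = C(x-x_1)(x-x_2)\cdots(x-x_d)$ of degree $d \ge 2$ with $x_1 \le x_2 \le \dots \le x_d$, its mesh is the minimal distance between its roots: $\operatorname{mesh}(R) = \min_{1 \le j \le d-1}(x_{j+1} - x_j)$ (so $\operatorname{mesh}(R) = 0$ if $R$ has a multiple root). If $P$ has degree $n\ge 1$, then $T_{\theta,h}(P)$ has degree $n$ if $\sin\theta \ne 0$ and degree $n-1$ if $\sin\theta = 0$. *)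

theory Defs
  imports Complex_Main "HOL-Computational_Algebra.Computational_Algebra"
begin

definition hyperbolic :: "real poly \<Rightarrow> bool" where
  "hyperbolic p \<longleftrightarrow>
     p = 0 \<or> (\<forall>z::complex. poly (map_poly of_real p) z = 0 \<longrightarrow> z \<in> \<real>)"

definition T_complex :: "real \<Rightarrow> real \<Rightarrow> complex poly \<Rightarrow> complex poly" where
  "T_complex \<theta> h P =
     smult (1 / \<i>)
       (smult (exp (\<i> * of_real \<theta>)) (pcompose P [:\<i> * of_real h, 1:])
        - smult (exp (- \<i> * of_real \<theta>)) (pcompose P [:- \<i> * of_real h, 1:]))"

lemma poly_T_complex:
  "poly (T_complex \<theta> h P) x =
     (exp (\<i> * of_real \<theta>) * poly P (x + \<i> * of_real h)
      - exp (- \<i> * of_real \<theta>) * poly P (x - \<i> * of_real h)) / \<i>"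
  by (simp add: T_complex_def poly_pcompose algebra_simps)

(* On a real polynomial, T_complex has real coefficients, so taking real parts of the
   coefficients only changes the type; this is the content of of_real_T below. *)
definition T :: "real \<Rightarrow> real \<Rightarrow> real poly \<Rightarrow> real poly" where
  "T \<theta> h P = map_poly Re (T_complex \<theta> h (map_poly of_real P))"

lemma cnj_poly_of_real:
  "cnj (poly (map_poly of_real P) z) = poly (map_poly of_real P) (cnj z)"
  by (induction P) (simp_all add: map_poly_pCons)

lemma of_real_T: "map_poly of_real (T \<theta> h P) = T_complex \<theta> h (map_poly of_real P)"
proof -
  define Q where "Q = T_complex \<theta> h (map_poly of_real P)"
  have e: "exp (\<i> * of_real \<theta>) = cis \<theta>" "exp (- \<i> * of_real \<theta>) = cis (- \<theta>)"
    by (simp_all add: cis_conv_exp)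
  have cnj_eval: "cnj (poly Q z) = poly Q (cnj z)" for z
    unfolding Q_def poly_T_complex e
    by (simp add: cnj_poly_of_real cis_cnj field_simps)
  have "poly (map_poly cnj Q) z = poly Q z" for z
  proof -
    have "poly (map_poly cnj Q) z = cnj (poly Q (cnj z))"
      by (induction Q) (simp_all add: map_poly_pCons)
    then show ?thesis by (simp add: cnj_eval)
  qed
  then have "map_poly cnj Q = Q"
    by (simp add: poly_eq_poly_eq_iff[symmetric] fun_eq_iff)
  then have "cnj (coeff Q n) = coeff Q n" for n
    by (metis (no_types) coeff_map_poly complex_cnj_zero)
  then have "of_real (Re (coeff Q n)) = coeff Q n" for n
    by (simp add: complex_eq_iff)
  then show ?thesis
    unfolding T_def Q_def[symmetric] by (intro poly_eqI) (simp add: coeff_map_poly)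
qed

(* Roots are listed in increasing order with multiplicity and indexed from 0, so the
   d roots have indices 0, ..., d - 1. Meaningful only for a hyperbolic polynomial of
   degree d >= 2, which has exactly d real roots with multiplicity. *)
definition mesh :: "real poly \<Rightarrow> real" where
  "mesh p = (let xs = sorted_list_of_multiset (proots p)
             in Min ((\<lambda>j. xs ! (j + 1) - xs ! j) ` {..<degree p - 1}))"

lemma mesh_factored:
  assumes "C \<noteq> 0" "sorted xs"
  shows "mesh (smult C (\<Prod>x\<leftarrow>xs. [:- x, 1:])) =
           Min ((\<lambda>j. xs ! (j + 1) - xs ! j) ` {..<length xs - 1})"
proof -
  have "proots (\<Prod>x\<leftarrow>xs. [:- x, 1:]) = mset xs"
    by (induction xs) (simp_all add: proots_mult prod_list_zero_iff image_iff del: mult_pCons_left)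
  moreover have "degree (\<Prod>x\<leftarrow>xs. [:- x, 1:]) = length xs"
    by (induction xs) (simp_all add: degree_mult_eq prod_list_zero_iff image_iff del: mult_pCons_left)
  ultimately show ?thesis
    using assms by (simp add: mesh_def sorted_list_of_multiset_mset sorted_sort_id)
qed

end

theory Submission
  imports Defs "HOL-Analysis.Analysis" "HOL-Real_Asymp.Real_Asymp"
begin

text \<open>
  Write \<open>P = c (x - a\<^sub>1) \<cdots> (x - a\<^sub>n)\<close> and \<open>\<psi>(x) = \<Sum> arctan ((x - a\<^sub>i) / h)\<close>. On the real line
  \<open>T(P)\<close> is a positive multiple of \<open>c sin (\<theta> + n \<pi> / 2 - \<psi>)\<close>, and \<open>\<psi>\<close> increases from \<open>- n \<pi> / 2\<close> to
  \<open>n \<pi> / 2\<close>, so all roots are real and simple and \<open>\<psi>\<close> grows by exactly \<open>\<pi>\<close> between consecutive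
  roots \<open>x < y\<close>. Put \<open>y - x = 2 h tan \<eta>\<close>, and let \<open>p\<^sub>i\<close>, \<open>q\<^sub>i\<close> be the arctangents at \<open>x\<close> and \<open>y\<close>. Then
  \<open>q\<^sub>i - p\<^sub>i = \<eta> + \<omega>(p\<^sub>i + q\<^sub>i)\<close> with \<open>\<omega>(t) = arcsin (sin \<eta> cos t)\<close>, while \<open>\<Sum> (p\<^sub>i + q\<^sub>i)\<close> is determined
  modulo \<open>2 \<pi>\<close> by \<open>\<theta>\<close> and \<open>n\<close>. If \<open>u\<close> is its representative of least absolute value, then
  \<open>\<Sum> \<omega>(p\<^sub>i + q\<^sub>i) \<le> n \<omega>(u / n)\<close>, although \<open>\<omega>\<close> is concave only near \<open>0\<close>. Hence \<open>\<pi> \<le> n \<eta> + n \<omega>(u / n)\<close>,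
  which says that the roots \<open>h tan ((u \<plusminus> \<pi>) / (2 n))\<close> of \<open>T(x\<^sup>n)\<close> are at most \<open>y - x\<close> apart.
\<close>

section \<open>Averaging inequalities for \<open>arcsin (k * cos t)\<close>\<close>

definition arcsin_cos :: "real \<Rightarrow> real \<Rightarrow> real" where
  "arcsin_cos k t = arcsin (k * cos t)"

context
  fixes k :: real
  assumes k: "0 \<le> k" "k < 1"
begin

lemma abs_mult_cos_less_1: "\<bar>k * cos t\<bar> < 1"
proof -
  have "\<bar>k * cos t\<bar> \<le> k * 1"
    unfolding abs_mult using k by (intro mult_mono) auto
  then show ?thesis using k by linarith
qed

lemma one_minus_sq_mult_cos_pos: "0 < 1 - (k * cos t)\<^sup>2"
  using abs_mult_cos_less_1[of t] by (simp add: abs_square_less_1)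

lemma has_derivative_arcsin_cos:
  "(arcsin_cos k has_real_derivative - (k * sin t / sqrt (1 - (k * cos t)\<^sup>2))) (at t)"
  unfolding arcsin_cos_def
  using abs_mult_cos_less_1[of t]
  by (auto intro!: derivative_eq_intros simp: field_simps abs_less_iff)

lemma arcsin_cos_abs [simp]: "arcsin_cos k \<bar>t\<bar> = arcsin_cos k t"
  by (simp add: arcsin_cos_def)

lemma arcsin_cos_antimono:
  assumes "0 \<le> s" "s \<le> t" "t \<le> pi"
  shows "arcsin_cos k t \<le> arcsin_cos k s"
proof -
  have "cos t \<le> cos s" using assms by (intro cos_monotone_0_pi_le) auto
  then have "k * cos t \<le> k * cos s" using k by (intro mult_left_mono) auto
  then show ?thesis
    unfolding arcsin_cos_def using abs_mult_cos_less_1[of s] abs_mult_cos_less_1[of t]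
    by (intro arcsin_le_arcsin) auto
qed

lemma arcsin_cos_pi_minus: "arcsin_cos k (pi - t) = - arcsin_cos k t"
  using abs_mult_cos_less_1[of t] by (simp add: arcsin_cos_def arcsin_minus)

lemma sin_arcsin_cos [simp]: "sin (arcsin_cos k t) = k * cos t"
  using abs_mult_cos_less_1[of t] by (simp add: arcsin_cos_def)

lemma arcsin_cos_bounds: "- (pi / 2) < arcsin_cos k t" "arcsin_cos k t < pi / 2"
  using abs_mult_cos_less_1[of t] arcsin_lt_bounded[of "k * cos t"]
  by (auto simp: arcsin_cos_def)

text \<open>The squares of \<open>k * sin u\<close> and \<open>k * cos u\<close> add up to
  \<open>k\<^sup>2 \<le> 1\<close>, so the derivative is at least -1.\<close>

lemma arcsin_cos_diff_le:
  assumes "s \<le> t"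
  shows "arcsin_cos k s - arcsin_cos k t \<le> t - s"
proof -
  have "k * sin u / sqrt (1 - (k * cos u)\<^sup>2) \<le> 1" for u
  proof -
    have "(k * sin u)\<^sup>2 \<le> 1 - (k * cos u)\<^sup>2"
    proof -
      have "(k * sin u)\<^sup>2 + (k * cos u)\<^sup>2 = k\<^sup>2"
        by (simp add: power_mult_distrib flip: distrib_left)
      moreover have "k\<^sup>2 \<le> 1" using k by (simp add: abs_square_le_1)
      ultimately show ?thesis by linarith
    qed
    then have "k * sin u \<le> sqrt (1 - (k * cos u)\<^sup>2)" by (rule real_le_rsqrt)
    then show ?thesis using one_minus_sq_mult_cos_pos[of u] by simp
  qed
  then have "s + arcsin_cos k s \<le> t + arcsin_cos k t"
    using has_derivative_arcsin_cos
    by (intro DERIV_nonneg_imp_nondecreasing[OF assms])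
       (force intro!: derivative_eq_intros)
  then show ?thesis by simp
qed

text \<open>With \<open>S = (sin t)\<^sup>2\<close>, the squared slope is
  \<open>k\<^sup>2 * S / ((1 - k\<^sup>2) + k\<^sup>2 * S)\<close>, which increases with
  \<open>S\<close>: the function falls ever more steeply.\<close>

lemma concave_arcsin_cos: "concave_on {0..pi/2} (arcsin_cos k)"
  unfolding concave_on_def
proof (rule convex_on_realI[where f' = "\<lambda>t. k * sin t / sqrt (1 - (k * cos t)\<^sup>2)"])
  fix s t :: real assume st: "s \<in> {0..pi/2}" "t \<in> {0..pi/2}" "s \<le> t"
  let ?D = "\<lambda>u. sqrt (1 - (k * cos u)\<^sup>2)"
  have D: "0 < ?D u" for u using one_minus_sq_mult_cos_pos by simp
  have sin: "0 \<le> sin s" "sin s \<le> sin t"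
    using st by (auto intro: sin_ge_zero sin_monotone_2pi_le)
  have "sin s * ?D t \<le> sin t * ?D s"
  proof (rule power2_le_imp_le)
    have D2: "(?D u)\<^sup>2 = (1 - k\<^sup>2) + k\<^sup>2 * (sin u)\<^sup>2" for u
    proof -
      have "(?D u)\<^sup>2 = 1 - (k * cos u)\<^sup>2"
        using one_minus_sq_mult_cos_pos[of u] by simp
      also have "\<dots> = (1 - k\<^sup>2) + k\<^sup>2 * (sin u)\<^sup>2"
        by (simp add: power_mult_distrib sin_squared_eq algebra_simps)
      finally show ?thesis .
    qed
    have "(sin s)\<^sup>2 * (1 - k\<^sup>2) \<le> (sin t)\<^sup>2 * (1 - k\<^sup>2)"
      using k sin by (intro mult_right_mono power_mono) (auto simp: abs_square_le_1)
    then show "(sin s * ?D t)\<^sup>2 \<le> (sin t * ?D s)\<^sup>2"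
      unfolding power_mult_distrib[of _ "sqrt _"] D2 by (simp add: algebra_simps)
    show "0 \<le> sin t * ?D s" using sin D[of s] by (intro mult_nonneg_nonneg) auto
  qed
  then have "sin s / ?D s \<le> sin t / ?D t"
    using D[of s] D[of t] by (simp add: divide_simps mult.commute)
  then show "k * sin s / ?D s \<le> k * sin t / ?D t"
    using k mult_left_mono[of "sin s / ?D s" "sin t / ?D t" k] by simp
next
  fix t show "((\<lambda>x. - arcsin_cos k x) has_real_derivative k * sin t / sqrt (1 - (k * cos t)\<^sup>2)) (at t)"
    using DERIV_minus[OF has_derivative_arcsin_cos[of t]] by simp
qed auto

text \<open>The midpoint inequality reaches beyond the interval of concavity: an argument in
  \<open>(\<pi> / 2, \<pi>]\<close> is allowed if the other one compensates for it. It follows from the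
  1-Lipschitz bound after turning both sums into products.\<close>
lemma arcsin_cos_midpoint:
  assumes "0 \<le> s" "0 \<le> t" "s + t \<le> pi"
  shows "arcsin_cos k s + arcsin_cos k t \<le> 2 * arcsin_cos k ((s + t) / 2)"
  using assms
proof (induction s t rule: linorder_wlog)
  case (le s t)
  define p q where "p = arcsin_cos k s" and "q = arcsin_cos k t"
  have pq: "0 \<le> (p - q) / 2" "(p - q) / 2 \<le> (t - s) / 2"
    using arcsin_cos_antimono[of s t] arcsin_cos_diff_le[of s t] le by (auto simp: p_def q_def)
  \<comment> \<open>Here \<open>s + t \<le> pi\<close> enters: the comparison of the two other
    cosines is later multiplied by this factor.\<close>
  have m: "0 \<le> cos ((s + t) / 2)" using le by (intro cos_ge_zero) auto
  have c: "cos ((s - t) / 2) \<le> cos ((p - q) / 2)" 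
  proof -
    have "(s - t) / 2 = - ((t - s) / 2)" by (simp add: field_simps)
    then have "cos ((s - t) / 2) = cos ((t - s) / 2)" by (simp only: cos_minus)
    also have "\<dots> \<le> cos ((p - q) / 2)" using pq le by (intro cos_monotone_0_pi_le) auto
    finally show ?thesis .
  qed
  have b: "- (pi/2) < p" "p < pi/2" "- (pi/2) < q" "q < pi/2"
    using arcsin_cos_bounds by (auto simp: p_def q_def)
  have "(t - s) / 2 \<le> pi / 2" using le by auto
  then have "0 < cos ((p - q) / 2)"
    using pq b by (intro cos_gt_zero_pi) auto
  have "sin p + sin q = k * (cos s + cos t)"
    by (simp add: p_def q_def algebra_simps)
  then have "sin ((p + q) / 2) * cos ((p - q) / 2) = k * cos ((s + t) / 2) * cos ((s - t) / 2)"
    by (simp add: sin_plus_sin cos_plus_cos)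
  also have "\<dots> \<le> k * cos ((s + t) / 2) * cos ((p - q) / 2)"
    using k m c by (intro mult_left_mono) auto
  finally have "sin ((p + q) / 2) \<le> sin (arcsin_cos k ((s + t) / 2))"
    using \<open>0 < cos ((p - q) / 2)\<close> by simp
  then have "(p + q) / 2 \<le> arcsin_cos k ((s + t) / 2)"
    using b arcsin_cos_bounds[of "(s + t) / 2"] by (subst (asm) sin_mono_le_eq) auto
  then show ?case by (simp add: p_def q_def)
next
  case (sym s t)
  then show ?case by (simp add: add.commute)
qed

text \<open>Jensen's inequality replaces the arguments by their mean, which is at least
  \<open>u / card I\<close>; antitonicity does the rest.\<close>

lemma sum_arcsin_cos_le_concave:
  assumes "finite I" "I \<noteq> {}"
    and t: "\<And>i. i \<in> I \<Longrightarrow> 0 \<le> t i" "\<And>i. i \<in> I \<Longrightarrow> t i \<le> pi / 2"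
    and u: "0 \<le> u" "u \<le> sum t I"
  shows "sum (\<lambda>i. arcsin_cos k (t i)) I \<le> card I * arcsin_cos k (u / card I)"
proof -
  let ?n = "real (card I)"
  have n: "?n > 0" using assms by (simp add: card_gt_0_iff)
  have "arcsin_cos k (\<Sum>i\<in>I. (1 / ?n) *\<^sub>R t i) \<ge> (\<Sum>i\<in>I. (1 / ?n) * arcsin_cos k (t i))"
    using assms n by (intro concave_on_sum[OF _ _ concave_arcsin_cos]) auto
  then have 1: "(\<Sum>i\<in>I. arcsin_cos k (t i)) \<le> ?n * arcsin_cos k (sum t I / ?n)"
    using n by (simp add: field_simps flip: sum_distrib_left sum_divide_distrib)
  have "sum t I \<le> ?n * (pi / 2)" using t(2) sum_bounded_above[of I t "pi/2"] by simp
  then have "sum t I / ?n \<le> pi / 2" using n by (simp add: field_simps)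
  then have "sum t I / ?n \<le> pi" using pi_ge_zero by linarith
  then have "arcsin_cos k (sum t I / ?n) \<le> arcsin_cos k (u / ?n)"
    using u n by (intro arcsin_cos_antimono divide_right_mono) auto
  with 1 show ?thesis using n by (meson mult_left_mono less_imp_le order_trans)
qed

lemma sum_arcsin_cos_le_nonneg:
  assumes "finite I" "card I \<ge> 2"
    and t: "\<And>i. i \<in> I \<Longrightarrow> 0 \<le> t i" "\<And>i. i \<in> I \<Longrightarrow> t i \<le> pi"
    and u: "0 \<le> u" "u \<le> pi" "u \<le> sum t I"
  shows "sum (\<lambda>i. arcsin_cos k (t i)) I \<le> card I * arcsin_cos k (u / card I)"
proof (cases "\<forall>i\<in>I. t i \<le> pi / 2")
  case True
  then show ?thesis using assms by (intro sum_arcsin_cos_le_concave) auto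
next
  case False
  then obtain a where a: "a \<in> I" "pi / 2 < t a" by (auto simp: not_le)
  txt \<open>Move all arguments into \<open>[0, \<pi> / 2]\<close>: either some \<open>b\<close> makes the contributions of \<open>a\<close> and \<open>b\<close>
    cancel, or \<open>a\<close> is the only large argument and can be averaged with any other one.\<close>
  have "\<exists>s. (\<forall>i\<in>I. 0 \<le> s i \<and> s i \<le> pi / 2) \<and> u \<le> sum s I \<and>
      (\<Sum>i\<in>I. arcsin_cos k (t i)) \<le> (\<Sum>i\<in>I. arcsin_cos k (s i))"
  proof -
    have split: "sum f I = f a + f b + sum f (I - {a, b})" if "b \<in> I" "a \<noteq> b" for b and f :: "_ \<Rightarrow> real"
    proof -
      have "sum f I = sum f (I - {a, b}) + sum f {a, b}"
        using that a assms by (intro sum.subset_diff) auto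
      then show ?thesis using that by simp
    qed
    show ?thesis
    proof (cases "\<exists>b\<in>I. b \<noteq> a \<and> t a + t b \<ge> pi")
      case True
      then obtain b where b: "b \<in> I" "a \<noteq> b" "t a + t b \<ge> pi" by force
      \<comment> \<open>The pair contributes at most 0, the value of two arguments \<pi>/2, and the
        other terms are largest at 0. The new total \<pi> still dominates \<open>u\<close>, by
        \<open>u \<le> pi\<close>.\<close>
      define s where "s = (\<lambda>i. if i \<in> {a, b} then pi / 2 else 0)"
      have "arcsin_cos k (t a) \<le> arcsin_cos k (pi - t b)"
        using b a t by (intro arcsin_cos_antimono) auto
      then have "arcsin_cos k (t a) + arcsin_cos k (t b) \<le> 0" by (simp add: arcsin_cos_pi_minus)
      moreover have "(\<Sum>i\<in>I-{a,b}. arcsin_cos k (t i)) \<le> (\<Sum>i\<in>I-{a,b}. arcsin_cos k 0)"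
        using t by (intro sum_mono arcsin_cos_antimono) auto
      moreover have "arcsin_cos k (pi / 2) = 0" by (simp add: arcsin_cos_def)
      ultimately have "(\<Sum>i\<in>I. arcsin_cos k (t i)) \<le> (\<Sum>i\<in>I. arcsin_cos k (s i))"
        using b by (simp add: split[of b] s_def)
      moreover have "sum s I = pi" using b by (simp add: split[of b] s_def)
      moreover have "\<forall>i\<in>I. 0 \<le> s i \<and> s i \<le> pi / 2" by (auto simp: s_def)
      ultimately show ?thesis using u by metis
    next
      case no: False
      have "\<not> I \<subseteq> {a}" using assms(2) card_mono[of "{a}" I] by auto
      then obtain b where b: "b \<in> I" "a \<noteq> b" by blast
      have no': "t a + t i < pi" if "i \<in> I" "i \<noteq> a" for i using no that not_le by blast
      with b have ab: "t a + t b < pi" by metis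
      \<comment> \<open>Averaging keeps the total. As \<open>t a\<close> exceeds \<pi>/2 but forms a
        sum below \<pi> with every other argument, no argument above \<pi>/2 remains.\<close>
      define s where "s = (\<lambda>i. if i \<in> {a, b} then (t a + t b) / 2 else t i)"
      have "arcsin_cos k (t a) + arcsin_cos k (t b) \<le> 2 * arcsin_cos k ((t a + t b) / 2)"
        using a b ab t by (intro arcsin_cos_midpoint) auto
      then have "(\<Sum>i\<in>I. arcsin_cos k (t i)) \<le> (\<Sum>i\<in>I. arcsin_cos k (s i))"
        using b by (simp add: split[of b] s_def)
      moreover have "sum s I = sum t I" using b by (simp add: split[of b] s_def)
      moreover have "\<forall>i\<in>I. 0 \<le> s i \<and> s i \<le> pi / 2"
      proof
        fix i assume i: "i \<in> I"
        then have "t i \<le> pi / 2" if "i \<noteq> a" using no'[of i] a that by linarith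
        then show "0 \<le> s i \<and> s i \<le> pi / 2"
          using a b ab t[OF a(1)] t[OF b(1)] t[OF i] by (auto simp: s_def)
      qed
      ultimately show ?thesis using u by metis
    qed
  qed
  then obtain s where s: "\<forall>i\<in>I. 0 \<le> s i \<and> s i \<le> pi / 2" "u \<le> sum s I"
    "(\<Sum>i\<in>I. arcsin_cos k (t i)) \<le> (\<Sum>i\<in>I. arcsin_cos k (s i))" by blast
  have "(\<Sum>i\<in>I. arcsin_cos k (s i)) \<le> card I * arcsin_cos k (u / card I)"
    using s u assms a by (intro sum_arcsin_cos_le_concave) auto
  with s show ?thesis by linarith
qed

text \<open>The function is even, so absolute values may be taken. Their total is at least
  \<open>\<bar>u\<bar>\<close>, because \<open>u\<close> has least absolute value in its class
  modulo 2\<pi>.\<close>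

lemma sum_arcsin_cos_le:
  fixes j :: int
  assumes "finite I" "card I \<ge> 2" and t: "\<And>i. i \<in> I \<Longrightarrow> \<bar>t i\<bar> \<le> pi"
    and u: "\<bar>u\<bar> \<le> pi" "sum t I = u + 2 * pi * j"
  shows "sum (\<lambda>i. arcsin_cos k (t i)) I \<le> card I * arcsin_cos k (u / card I)"
proof -
  have "\<bar>u\<bar> \<le> \<bar>sum t I\<bar>"
  proof (cases "j = 0")
    case False
    then have "1 \<le> \<bar>real_of_int j\<bar>" by linarith
    then have "2 * pi \<le> \<bar>2 * pi * j\<bar>" by (simp add: abs_mult)
    then show ?thesis using u by linarith
  qed (use u in simp)
  also have "\<dots> \<le> (\<Sum>i\<in>I. \<bar>t i\<bar>)" by (rule sum_abs)
  finally have "(\<Sum>i\<in>I. arcsin_cos k \<bar>t i\<bar>) \<le> card I * arcsin_cos k (\<bar>u\<bar> / card I)"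
    using assms by (intro sum_arcsin_cos_le_nonneg) auto
  moreover have "\<bar>u\<bar> / card I = \<bar>u / card I\<bar>" by simp
  ultimately show ?thesis by (simp only: arcsin_cos_abs)
qed

end


section \<open>Factorization of hyperbolic polynomials and values of \<open>T\<close> on the real
  line\<close>

lemma poly_of_real_poly_of_real:
  "poly (map_poly of_real p) (of_real x :: 'a :: real_field) = of_real (poly p x)"
  by (induction p) (simp_all add: map_poly_pCons)

lemma poly_of_real_poly_mult:
  "poly (map_poly of_real (p * q)) (z :: 'a :: real_field)
     = poly (map_poly of_real p) z * poly (map_poly of_real q) z"
proof (induction p)
  case (pCons a p)
  have add: "map_poly of_real (r + s) = map_poly of_real r + (map_poly of_real s :: 'a poly)" for r s
    by (intro poly_eqI) (simp add: coeff_map_poly)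
  have smult: "map_poly of_real (smult b r) = smult (of_real b) (map_poly of_real r :: 'a poly)" for b r
    by (intro poly_eqI) (simp add: coeff_map_poly)
  show ?case using pCons by (simp add: map_poly_pCons add smult algebra_simps)
qed simp

text \<open>The fundamental theorem of algebra gives a zero, hyperbolicity makes it real, and the
  cofactor stays hyperbolic because its zeros are zeros of \<open>P\<close>.\<close>

lemma hyperbolic_factorization:
  assumes "hyperbolic P" "P \<noteq> 0"
  shows "\<exists>c a. c \<noteq> 0 \<and> P = smult c (\<Prod>i<degree P. [:- a i, 1:])"
  using assms
proof (induction "degree P" arbitrary: P)
  case 0
  then obtain c where "P = [:c:]" by (metis degree_eq_zeroE)
  then show ?case using 0 by (intro exI[of _ c]) auto
next
  case (Suc n)
  have "degree (map_poly complex_of_real P) = Suc n" using Suc by (simp add: degree_map_poly)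
  then have "\<not> constant (poly (map_poly complex_of_real P))" by (simp add: constant_degree)
  then obtain z where z: "poly (map_poly complex_of_real P) z = 0"
    using fundamental_theorem_of_algebra by blast
  with Suc have "z \<in> \<real>" by (auto simp: hyperbolic_def)
  then obtain x where "z = of_real x" by (auto elim: Reals_cases)
  with z have "poly P x = 0" by (simp add: poly_of_real_poly_of_real)
  then obtain Q where Q: "P = [:- x, 1:] * Q" by (auto simp: poly_eq_0_iff_dvd dvd_def)
  have "Q \<noteq> 0" using Q Suc by auto
  then have "degree P = Suc (degree Q)" using Q by (simp add: degree_mult_eq del: mult_pCons_left)
  moreover have "hyperbolic Q"
  proof -
    have "poly (map_poly complex_of_real P) w
        = (w - of_real x) * poly (map_poly complex_of_real Q) w" for w
      unfolding Q poly_of_real_poly_mult by (simp add: map_poly_pCons)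
    then show ?thesis using Suc by (auto simp: hyperbolic_def)
  qed
  ultimately obtain c a where "c \<noteq> 0" "Q = smult c (\<Prod>i<n. [:- a i, 1:])"
    using Suc(1)[of Q] \<open>Q \<noteq> 0\<close> Suc(2) by auto
  then have "P = smult c (\<Prod>i<Suc n. [:- (a(n := x)) i, 1:])"
    by (simp only: Q prod.lessThan_Suc mult_smult_right) (simp add: mult.commute)
  then have "P = smult c (\<Prod>i<degree P. [:- (a(n := x)) i, 1:])"
    by (simp only: Suc(2))
  then show ?case using \<open>c \<noteq> 0\<close> by blast
qed

text \<open>The value is twice the imaginary part of \<open>cis \<theta>\<close> times the
  polynomial at x + ih. Each factor there has argument \<pi>/2 - arctan ((x - \<open>a i\<close>) /
  h), and arguments add up; \<open>r\<close> is the product of the moduli.\<close>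

lemma poly_T_linear_factors:
  fixes a :: "nat \<Rightarrow> real"
  assumes "h > 0"
  shows "\<exists>r>0. poly (T \<theta> h (smult c (\<Prod>i<n. [:- a i, 1:]))) x
    = 2 * c * r * sin (\<theta> + n * pi / 2 - (\<Sum>i<n. arctan ((x - a i) / h)))"
proof -
  let ?P = "smult c (\<Prod>i<n. [:- a i, 1:])"
  define r where "r = (\<Prod>i<n. h * sqrt (1 + ((x - a i) / h)\<^sup>2))"
  define \<phi> where "\<phi> = n * pi / 2 - (\<Sum>i<n. arctan ((x - a i) / h))"
  have lin: "of_real x + \<i> * of_real h - of_real b
      = complex_of_real (h * sqrt (1 + ((x - b) / h)\<^sup>2)) * cis (pi / 2 - arctan ((x - b) / h))" for b
  proof -
    have "sqrt (1 + ((x - b) / h)\<^sup>2) \<noteq> 0" by (smt (verit) real_sqrt_eq_zero_cancel_iff zero_le_power2)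
    then show ?thesis using assms
      by (simp add: complex_eq_iff cos_diff sin_diff sin_arctan cos_arctan)
  qed
  have "poly (map_poly of_real (\<Prod>i<m. [:- a i, 1:])) z = (\<Prod>i<m. z - of_real (a i))"
    for m and z :: complex
    by (induction m) (simp_all add: poly_of_real_poly_mult map_poly_pCons del: mult_pCons_right)
  then have "poly (map_poly of_real ?P) z = of_real c * (\<Prod>i<n. z - of_real (a i))" for z :: complex
    using poly_of_real_poly_mult[of "[:c:]" "\<Prod>i<n. [:- a i, 1:]" z] by (simp add: map_poly_pCons)
  then have "poly (map_poly of_real ?P) (of_real x + \<i> * of_real h)
      = of_real c * (\<Prod>i<n. complex_of_real (h * sqrt (1 + ((x - a i) / h)\<^sup>2)) * cis (pi / 2 - arctan ((x - a i) / h)))"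
    by (simp only: lin)
  also have "(\<Prod>i<n. complex_of_real (h * sqrt (1 + ((x - a i) / h)\<^sup>2)) * cis (pi / 2 - arctan ((x - a i) / h)))
     = of_real r * cis \<phi>"
  proof -
    have "(\<Prod>i<m. complex_of_real (f i) * cis (g i)) = of_real (\<Prod>i<m. f i) * cis (\<Sum>i<m. g i)"
      for f g and m :: nat
      by (induction m) (simp_all flip: cis_mult)
    then show ?thesis by (simp only: r_def \<phi>_def sum_subtractf) simp
  qed
  finally have P: "poly (map_poly of_real ?P) (of_real x + \<i> * of_real h) = of_real c * (of_real r * cis \<phi>)" .
  have P': "poly (map_poly of_real ?P) (of_real x - \<i> * of_real h) = of_real c * (of_real r * cis (- \<phi>))"
    using arg_cong[OF P, of cnj] unfolding cnj_poly_of_real by (simp add: cis_cnj)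
  have "complex_of_real (poly (T \<theta> h ?P) x) = poly (T_complex \<theta> h (map_poly of_real ?P)) (of_real x)"
    by (simp only: of_real_T flip: poly_of_real_poly_of_real)
  also have "\<dots> = (cis \<theta> * (of_real c * (of_real r * cis \<phi>)) - cis (-\<theta>) * (of_real c * (of_real r * cis (- \<phi>)))) / \<i>"
    unfolding poly_T_complex P P' by (simp add: cis_conv_exp)
  also have "\<dots> = of_real c * of_real r * ((cis (\<theta> + \<phi>) - cis (- (\<theta> + \<phi>))) / \<i>)"
    by (simp add: algebra_simps cis_mult flip: diff_divide_distrib)
  also have "\<dots> = complex_of_real (2 * c * r * sin (\<theta> + \<phi>))"
  proof -
    have "cis t - cis (- t) = of_real (2 * sin t) * \<i>" for t by (simp add: complex_eq_iff)
    then have "(cis t - cis (- t)) / \<i> = of_real (2 * sin t)" for t by simp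
    then show ?thesis by (simp only: of_real_mult of_real_numeral) simp
  qed
  finally have "complex_of_real (poly (T \<theta> h ?P) x) = complex_of_real (2 * c * r * sin (\<theta> + \<phi>))" .
  then have "poly (T \<theta> h ?P) x = 2 * c * r * sin (\<theta> + \<phi>)" by (simp only: of_real_eq_iff)
  moreover have "r > 0" using assms unfolding r_def
    by (intro prod_pos) (simp add: add_pos_nonneg)
  moreover have "\<theta> + \<phi> = \<theta> + n * pi / 2 - (\<Sum>i<n. arctan ((x - a i) / h))" by (simp add: \<phi>_def)
  ultimately show ?thesis by metis
qed

text \<open>Both shifts preserve the leading coefficient. For nonzero \<open>P\<close> the degree
  therefore drops exactly when sin \<theta> = 0.\<close>

lemma coeff_T_degree: "coeff (T \<theta> h P) (degree P) = 2 * sin \<theta> * lead_coeff P"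
proof -
  let ?Q = "map_poly complex_of_real P"
  have "coeff (pcompose ?Q [:b, 1:]) (degree P) = of_real (lead_coeff P)" for b
  proof -
    have "degree (pcompose ?Q [:b, 1:]) = degree P" by (simp add: degree_pcompose degree_map_poly)
    then have "coeff (pcompose ?Q [:b, 1:]) (degree P) = lead_coeff (pcompose ?Q [:b, 1:])" by simp
    also have "\<dots> = lead_coeff ?Q" by (subst lead_coeff_comp) auto
    finally show ?thesis by (simp add: degree_map_poly coeff_map_poly)
  qed
  then have "coeff (T_complex \<theta> h ?Q) (degree P)
     = 1 / \<i> * (cis \<theta> * of_real (lead_coeff P) - cis (- \<theta>) * of_real (lead_coeff P))"
    by (simp add: T_complex_def cis_conv_exp)
  then show ?thesis by (simp add: T_def coeff_map_poly)
qed

lemma degree_T_le: "degree (T \<theta> h P) \<le> degree P"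
proof -
  have "degree (T_complex \<theta> h (map_poly of_real P)) \<le> degree P"
    unfolding T_complex_def
    by (intro order_trans[OF degree_smult_le] degree_diff_le)
       (auto intro!: order_trans[OF degree_smult_le] simp: degree_pcompose degree_map_poly)
  then show ?thesis unfolding T_def by (meson map_poly_degree_leq order_trans)
qed

section \<open>Mesh of a polynomial whose roots are real and simple\<close>

context
  fixes p :: "real poly"
  assumes nz: "p \<noteq> 0" and simple: "card {x. poly p x = 0} = degree p" and deg: "degree p \<ge> 2"
begin

lemma proots_simple: "proots p = mset_set {x. poly p x = 0}"
proof -
  have "mset_set {x. poly p x = 0} \<subseteq># proots p"
    using nz poly_roots_finite[OF nz] mset_set_set_mset_msubset[of "proots p"] by simp
  moreover have "size (proots p) \<le> size (mset_set {x. poly p x = 0})"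
    using size_proots_le[of p] simple by simp
  ultimately show ?thesis
    by (metis mset_subset_size not_le subset_mset.le_imp_less_or_eq)
qed

text \<open>Frees the comparison from sorted lists: the first part serves T(P), the second
  T(x^n).\<close>

lemma mesh_simple_roots:
  shows "\<exists>x y. x < y \<and> poly p x = 0 \<and> poly p y = 0 \<and> mesh p = y - x"
    and "x < y \<Longrightarrow> poly p x = 0 \<Longrightarrow> poly p y = 0 \<Longrightarrow> mesh p \<le> y - x"
proof -
  define xs where "xs = sorted_list_of_set {x. poly p x = 0}"
  have fin: "finite {x. poly p x = 0}" using nz by (rule poly_roots_finite)
  have xs: "sorted_wrt (<) xs" "set xs = {x. poly p x = 0}" "length xs = degree p"
    unfolding xs_def using fin simple by simp_all
  have mesh: "mesh p = Min ((\<lambda>j. xs ! (j + 1) - xs ! j) ` {..<degree p - 1})"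
    by (simp add: mesh_def Let_def proots_simple sorted_list_of_mset_set xs_def)
  have "mesh p \<in> (\<lambda>j. xs ! (j + 1) - xs ! j) ` {..<degree p - 1}"
    unfolding mesh using deg by (intro Min_in) (auto simp: lessThan_empty_iff)
  then obtain j where j: "j < degree p - 1" "mesh p = xs ! (j + 1) - xs ! j"
    by blast
  have less: "xs ! i < xs ! i'" if "i < i'" "i' < degree p" for i i'
    using sorted_wrt_nth_less[OF xs(1) that(1)] that(2) xs(3) by simp
  have root: "poly p (xs ! i) = 0" if "i < degree p" for i
    using nth_mem[of i xs] that xs(2,3) by simp
  have j': "j < j + 1" "j + 1 < degree p" using j(1) by auto
  show "\<exists>x y. x < y \<and> poly p x = 0 \<and> poly p y = 0 \<and> mesh p = y - x"
    using less[OF j'] root j(2) j' by (meson less_trans)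
  assume xy: "x < y" "poly p x = 0" "poly p y = 0"
  then have "x \<in> set xs" "y \<in> set xs" unfolding xs(2) by simp_all
  then obtain i j where ij: "i < degree p" "j < degree p" "x = xs ! i" "y = xs ! j"
    unfolding in_set_conv_nth xs(3) by blast
  have "i < j"
    using xy(1) less[of j i] ij by (cases i j rule: linorder_cases) auto
  \<comment> \<open>The right neighbour of \<open>x\<close> is not beyond \<open>y\<close>, so
    adjacent pairs suffice.\<close>
  then have "xs ! (i + 1) \<le> xs ! j"
    using less[of "i + 1" j] ij(2) by (cases "i + 1 = j") auto
  moreover have "mesh p \<le> xs ! (i + 1) - xs ! i"
  proof -
    have "i < degree p - 1" using \<open>i < j\<close> ij(2) by linarith
    then show ?thesis unfolding mesh by (intro Min_le) auto
  qed
  ultimately show "mesh p \<le> y - x" using ij by simp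
qed

end


section \<open>The gap forced by an increase of \<pi> in the arctangent sum\<close>

lemma arctan_diff_le:
  assumes \<eta>: "0 < \<eta>" "\<eta> < pi / 2" and v: "v - u = 2 * tan \<eta>"
  shows "arctan v - arctan u \<le> \<eta> + arcsin_cos (sin \<eta>) (arctan u + arctan v)"
proof -
  define p q where "p = arctan u" and "q = arctan v"
  define d where "d = q - p - \<eta>"
  have k: "0 \<le> sin \<eta>" "sin \<eta> < 1"
    using \<eta> sin_gt_zero2[of \<eta>] sin_monotone_2pi[of \<eta> "pi / 2"] by auto
  have pq: "- (pi / 2) < p" "q < pi / 2" using arctan_bounded by (auto simp: p_def q_def)
  have "0 < tan \<eta>" using \<eta> by (rule tan_gt_zero)
  then have "p < q" using v by (simp add: p_def q_def arctan_less_iff)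
  have cos: "cos p \<noteq> 0" "cos q \<noteq> 0" "cos \<eta> \<noteq> 0"
    using cos_gt_zero_pi[of \<eta>] \<eta> by (auto simp: p_def q_def)
  \<comment> \<open>Clearing denominators here leads to
    \<open>sin d = sin \<eta> * cos (p + q)\<close>; arcsin recovers \<open>d\<close> once
    \<open>\<bar>d\<bar> \<le> pi / 2\<close> is known.\<close>
  have "tan q - tan p = 2 * tan \<eta>" using v by (simp add: p_def q_def tan_arctan)
  then have "(sin q * cos p - cos q * sin p) * cos \<eta> = 2 * sin \<eta> * (cos p * cos q)"
    using cos by (simp add: tan_def field_simps)
  moreover have "sin d = (sin q * cos p - cos q * sin p) * cos \<eta> - cos (q - p) * sin \<eta>"
    by (simp only: d_def sin_diff[of "q - p" \<eta>] sin_diff[of q p])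
  ultimately have "sin d = sin \<eta> * (2 * (cos p * cos q) - cos (q - p))"
    by (simp only:) (simp add: algebra_simps)
  then have sin_d: "sin d = sin \<eta> * cos (p + q)"
    by (simp add: cos_add cos_diff algebra_simps)
  \<comment> \<open>Otherwise \<eta> < \<pi> - d < \<pi>/2, since q - p < \<pi>, and sin d would
    exceed sin \<eta>.\<close>
  have "d \<le> pi / 2"
  proof (rule ccontr)
    assume "\<not> d \<le> pi / 2"
    then have "sin \<eta> < sin (pi - d)" using pq \<eta> by (intro sin_monotone_2pi) (auto simp: d_def)
    moreover have "sin \<eta> * cos (p + q) \<le> sin \<eta> * 1" using k by (intro mult_left_mono) auto
    ultimately show False using sin_d by simp
  qed
  moreover have "- (pi / 2) \<le> d" using \<open>p < q\<close> \<eta> by (auto simp: d_def)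
  ultimately have "arcsin (sin d) = d" by (intro arcsin_sin) auto
  then have "d = arcsin_cos (sin \<eta>) (p + q)" by (simp add: arcsin_cos_def sin_d)
  then show ?thesis by (simp add: d_def p_def q_def)
qed

definition arctan_sum :: "(nat \<Rightarrow> real) \<Rightarrow> real \<Rightarrow> nat \<Rightarrow> real \<Rightarrow> real" where
  "arctan_sum a h n x = (\<Sum>i<n. arctan ((x - a i) / h))"

text \<open>The conclusion is \<pi>/n - \<eta> \<le> \<omega>(u/n) after taking sines and solving
  for tan \<eta>, with denominators cleared.\<close>

lemma arctan_sum_shift_gap:
  fixes a :: "nat \<Rightarrow> real" and j :: int
  assumes "h > 0" "n \<ge> 2" "x < y" and shift: "arctan_sum a h n y = arctan_sum a h n x + pi"
    and u: "\<bar>u\<bar> \<le> pi" "arctan_sum a h n x + arctan_sum a h n y = u + 2 * pi * j"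
  shows "2 * h * sin (pi / n) \<le> (y - x) * (cos (pi / n) + cos (u / n))"
proof -
  define \<eta> where "\<eta> = arctan ((y - x) / (2 * h))"
  have \<eta>: "0 < \<eta>" "\<eta> < pi / 2" and tan: "tan \<eta> = (y - x) / (2 * h)"
    using assms arctan_bounded by (auto simp: \<eta>_def tan_arctan)
  have k: "0 \<le> sin \<eta>" "sin \<eta> < 1"
    using \<eta> sin_gt_zero2[of \<eta>] sin_monotone_2pi[of \<eta> "pi / 2"] by auto
  let ?\<omega> = "arcsin_cos (sin \<eta>)"
  let ?t = "\<lambda>i. arctan ((x - a i) / h) + arctan ((y - a i) / h)"
  have "arctan ((y - a i) / h) - arctan ((x - a i) / h) \<le> \<eta> + ?\<omega> (?t i)" for i
    using \<eta> \<open>h > 0\<close> by (intro arctan_diff_le) (auto simp: tan field_simps)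
  then have "(\<Sum>i<n. arctan ((y - a i) / h) - arctan ((x - a i) / h)) \<le> (\<Sum>i<n. \<eta> + ?\<omega> (?t i))"
    by (rule sum_mono)
  then have "pi \<le> n * \<eta> + (\<Sum>i<n. ?\<omega> (?t i))"
    using shift by (simp add: arctan_sum_def sum_subtractf sum.distrib)
  also have "(\<Sum>i<n. ?\<omega> (?t i)) \<le> n * ?\<omega> (u / n)"
  proof -
    have "\<bar>?t i\<bar> \<le> pi" for i
      using arctan_bounded[of "(x - a i) / h"] arctan_bounded[of "(y - a i) / h"]
      unfolding abs_le_iff by linarith
    then show ?thesis
      using sum_arcsin_cos_le[OF k, of "{..<n}" ?t u j] u \<open>n \<ge> 2\<close> by (simp add: arctan_sum_def sum.distrib)
  qed
  finally have "pi / n - \<eta> \<le> ?\<omega> (u / n)" using \<open>n \<ge> 2\<close> by (simp add: field_simps)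
  moreover have "0 \<le> pi / n" by simp
  then have "- (pi / 2) \<le> pi / n - \<eta>" using \<eta> by linarith
  ultimately have "sin (pi / n - \<eta>) \<le> sin (?\<omega> (u / n))"
    using arcsin_cos_bounds(2)[OF k, of "u / n"] by (intro sin_monotone_2pi_le) auto
  then have "sin (pi / n) * cos \<eta> \<le> sin \<eta> * (cos (pi / n) + cos (u / n))"
    by (simp add: sin_arcsin_cos[OF k] sin_diff algebra_simps)
  moreover have c: "cos \<eta> > 0" using \<eta> by (intro cos_gt_zero_pi) auto
  ultimately have "sin (pi / n) \<le> tan \<eta> * (cos (pi / n) + cos (u / n))"
    by (simp add: tan_def field_simps)
  then show ?thesis using \<open>h > 0\<close> by (simp add: tan field_simps)
qed

section \<open>Number and simplicity of the real roots of \<open>T \<theta> h P\<close>\<close>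

context
  fixes a :: "nat \<Rightarrow> real" and c h \<theta> :: real and n :: nat and P :: "real poly"
  assumes P: "P = smult c (\<Prod>i<n. [:- a i, 1:])" and c: "c \<noteq> 0" and h: "h > 0" and n: "n \<ge> 2"
begin

abbreviation "\<psi> \<equiv> arctan_sum a h n"

lemma poly_T_eq_0_iff: "poly (T \<theta> h P) x = 0 \<longleftrightarrow> sin (\<theta> + n * pi / 2 - \<psi> x) = 0"
proof -
  obtain r where "r > 0" "poly (T \<theta> h P) x = 2 * c * r * sin (\<theta> + n * pi / 2 - \<psi> x)"
    using poly_T_linear_factors[OF h, where \<theta> = \<theta> and c = c and n = n and a = a and x = x]
    unfolding P arctan_sum_def by blast
  then show ?thesis using c by (simp only:) simp
qed

lemma arctan_sum_less: "x < y \<Longrightarrow> \<psi> x < \<psi> y"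
  unfolding arctan_sum_def using n h
  by (intro sum_strict_mono) (auto simp: arctan_less_iff divide_strict_right_mono lessThan_empty_iff)

lemma arctan_sum_continuous: "continuous_on A \<psi>"
  unfolding arctan_sum_def using h by (intro continuous_intros) auto

lemma arctan_sum_surj:
  assumes "\<bar>v\<bar> < n * pi / 2"
  shows "\<exists>x. \<psi> x = v"
proof -
  have top: "filterlim (\<lambda>x. (x - b) / h) at_top at_top" for b using h by real_asymp
  have bot: "filterlim (\<lambda>x. (x - b) / h) at_bot at_bot" for b using h by real_asymp
  have "(\<psi> \<longlongrightarrow> (\<Sum>i<n. pi / 2)) at_top" unfolding arctan_sum_def
    by (intro tendsto_sum filterlim_compose[OF tendsto_arctan_at_top top])
  then have "\<forall>\<^sub>F x in at_top. v < \<psi> x" using assms by (intro order_tendstoD) auto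
  then obtain y where y: "v < \<psi> y" by (auto simp: eventually_at_top_linorder)
  have "(\<psi> \<longlongrightarrow> (\<Sum>i<n. - (pi / 2))) at_bot" unfolding arctan_sum_def
    by (intro tendsto_sum filterlim_compose[OF tendsto_arctan_at_bot bot])
  then have "\<forall>\<^sub>F x in at_bot. \<psi> x < v" using assms by (intro order_tendstoD) auto
  then obtain x where x: "\<psi> x < v" by (auto simp: eventually_at_bot_linorder)
  have "x \<le> y" using x y arctan_sum_less[of y x] by (cases "y < x") auto
  then show ?thesis using IVT'[of \<psi> x v y] x y arctan_sum_continuous by auto
qed

text \<open>Otherwise the sine would vanish at two phases \<pi>/2 apart: for n \<ge> 2 both 0 and
  \<pi>/2 are values of \<psi>.\<close>

lemma T_neq_0: "T \<theta> h P \<noteq> 0"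
proof
  assume "T \<theta> h P = 0"
  then have 0: "sin (\<theta> + n * pi / 2 - \<psi> x) = 0" for x using poly_T_eq_0_iff[of x] by simp
  have "2 * pi \<le> n * pi" using n by simp
  then have range: "\<bar>0\<bar> < n * pi / 2" "\<bar>pi / 2\<bar> < n * pi / 2" using pi_gt_zero by linarith+
  obtain x y where xy: "\<psi> x = 0" "\<psi> y = pi / 2"
    using arctan_sum_surj[OF range(1)] arctan_sum_surj[OF range(2)] by auto
  let ?s = "\<theta> + n * pi / 2"
  have "sin ?s = 0" using 0[of x] xy by simp
  moreover have "cos ?s = 0" using 0[of y] xy by (simp add: sin_diff)
  ultimately show False using sin_cos_squared_add[of ?s] by simp
qed

lemma degree_P: "degree P = n"
proof -
  have "degree (\<Prod>i<n. [:- a i, 1:]) = (\<Sum>i<n. degree [:- a i, 1:])"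
    by (intro degree_prod_eq_sum_degree) auto
  then show ?thesis using c by (simp add: P)
qed

text \<open>The phase \<theta> + n\<pi>/2 - \<psi>(x) sweeps the open interval from \<theta> to
  \<theta> + n\<pi>. It contains \<open>N\<close> multiples of \<pi>, and \<open>N\<close> also
  bounds the degree.\<close>

lemma T_simple_roots:
  assumes "n \<ge> 3 \<or> sin \<theta> \<noteq> 0"
  shows "card {x. poly (T \<theta> h P) x = 0} = degree (T \<theta> h P)" "degree (T \<theta> h P) \<ge> 2"
proof -
  let ?R = "{x. poly (T \<theta> h P) x = 0}"
  define N where "N = (if sin \<theta> = 0 then n - 1 else n)"
  \<comment> \<open>(m + 1)\<pi> is the first multiple of \<pi> beyond \<theta>, so the roots are
    matched with (m + 1 + i)\<pi> for i < N.\<close>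
  define m where "m = \<lfloor>\<theta> / pi\<rfloor>"
  have m: "m * pi \<le> \<theta>" "\<theta> < (m + 1) * pi"
    using floor_divide_lower[of pi \<theta>] floor_divide_upper[of pi \<theta>] by (auto simp: m_def)
  have "\<exists>x. \<psi> x = \<theta> + n * pi / 2 - (m + 1 + int i) * pi" if "i < N" for i
  proof -
    have *: "(real i + 1) * pi \<le> N * pi" using that by (intro mult_right_mono) auto
    \<comment> \<open>The last multiple (m + N)\<pi> stays below \<theta> + n\<pi>: if sin \<theta>
      = 0 because N = n - 1, otherwise because m\<pi> < \<theta> is strict.\<close>
    have **: "N * pi + m * pi < n * pi + \<theta>"
    proof (cases "sin \<theta> = 0")
      case True
      then have "N * pi = n * pi - pi" using n by (simp add: N_def of_nat_diff algebra_simps)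
      then show ?thesis using m pi_gt_zero by linarith
    next
      case False
      then have "m * pi \<noteq> \<theta>" by (auto simp: sin_zero_iff_int2)
      then show ?thesis using m False by (simp add: N_def)
    qed
    have ***: "0 \<le> real i * pi" by simp
    have "\<bar>\<theta> + n * pi / 2 - (m + 1 + int i) * pi\<bar> < n * pi / 2"
    proof -
      have "(m + 1 + int i) * pi = m * pi + pi + i * pi" by (simp add: algebra_simps)
      moreover have "(m + 1) * pi = m * pi + pi" by (simp add: algebra_simps)
      moreover have "(real i + 1) * pi = i * pi + pi" by (simp add: algebra_simps)
      ultimately show ?thesis using * ** *** m by linarith
    qed
    then show ?thesis by (rule arctan_sum_surj)
  qed
  then have "\<forall>i. \<exists>x. i < N \<longrightarrow> \<psi> x = \<theta> + n * pi / 2 - (m + 1 + int i) * pi" by blast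
  from choice[OF this] obtain z
    where z: "\<psi> (z i) = \<theta> + n * pi / 2 - (m + 1 + int i) * pi" if "i < N" for i
    by blast
  have "inj_on z {..<N}"
  proof (rule inj_onI)
    fix i j assume ij: "i \<in> {..<N}" "j \<in> {..<N}" "z i = z j"
    then have "\<theta> + n * pi / 2 - (m + 1 + int i) * pi = \<theta> + n * pi / 2 - (m + 1 + int j) * pi"
      by (metis z lessThan_iff)
    then have "(m + 1 + int i) * pi = (m + 1 + int j) * pi" by (rule diff_left_imp_eq)
    then have "real_of_int (m + 1 + int i) = real_of_int (m + 1 + int j)"
      unfolding mult_cancel_right using pi_neq_zero by blast
    then show "i = j" by simp
  qed
  then have "card (z ` {..<N}) = N" by (simp add: card_image)
  moreover have "z ` {..<N} \<subseteq> ?R"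
  proof (clarify)
    fix i assume "i < N"
    then have "\<theta> + n * pi / 2 - \<psi> (z i) = real_of_int (m + 1 + int i) * pi"
      by (simp only: z diff_diff_eq2 add_diff_cancel_left')
    then show "poly (T \<theta> h P) (z i) = 0" unfolding poly_T_eq_0_iff sin_zero_iff_int2 by blast
  qed
  moreover have "finite ?R" using T_neq_0 by (rule poly_roots_finite)
  ultimately have "N \<le> card ?R" using card_mono by metis
  moreover have "card ?R \<le> degree (T \<theta> h P)" using T_neq_0 by (rule card_poly_roots_bound)
  moreover have "degree (T \<theta> h P) \<le> N"
  proof (cases "sin \<theta> = 0")
    case True
    then have "coeff (T \<theta> h P) n = 0" using coeff_T_degree[of \<theta> h P] by (simp add: degree_P)
    then have "degree (T \<theta> h P) \<noteq> n" using T_neq_0 by auto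
    then show ?thesis using True degree_T_le[of \<theta> h P] by (simp add: N_def degree_P)
  next
    case False
    then show ?thesis using degree_T_le[of \<theta> h P] by (simp add: N_def degree_P)
  qed
  moreover have "N \<ge> 2" using assms n by (auto simp: N_def)
  ultimately show "card ?R = degree (T \<theta> h P)" "degree (T \<theta> h P) \<ge> 2" by linarith+
qed

end

section \<open>Comparison with the roots of T(x^n)\<close>

text \<open>The form \<open>- 0\<close> and the factor 1 match the factored shape assumed of
  \<open>P\<close>, so that the root results apply to x^n.\<close>

lemma monom_eq_prod: "monom 1 n = smult 1 (\<Prod>i<n. [:- 0, 1 :: 'a :: comm_ring_1:])"
  by (simp add: monom_altdef)

lemma poly_T_monom_eq_0:
  assumes "h > 0" "n \<ge> 2" "\<bar>s\<bar> < pi / 2" "sin (\<theta> + n * pi / 2 - n * s) = 0"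
  shows "poly (T \<theta> h (monom 1 n)) (h * tan s) = 0"
proof -
  have "arctan (tan s) = s" using assms by (intro arctan_tan) auto
  then have "arctan_sum (\<lambda>_. 0) h n (h * tan s) = n * s" using assms by (simp add: arctan_sum_def)
  then show ?thesis using assms by (subst poly_T_eq_0_iff[OF monom_eq_prod]) auto
qed

lemma T_root_gap:
  assumes P: "P = smult c (\<Prod>i<n. [:- a i, 1:])" "c \<noteq> 0" and h: "h > 0" and n: "n \<ge> 2"
    and n3: "n \<ge> 3 \<or> sin \<theta> \<noteq> 0"
    and xy: "x < y" "poly (T \<theta> h P) x = 0" "poly (T \<theta> h P) y = 0"
  shows "\<exists>x' y'. x' < y' \<and> poly (T \<theta> h (monom 1 n)) x' = 0 \<and> poly (T \<theta> h (monom 1 n)) y' = 0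
    \<and> y' - x' \<le> y - x"
proof -
  let ?\<psi> = "arctan_sum a h n"
  note ctx = P h n
  from xy obtain k l :: int where kl: "\<theta> + n * pi / 2 - ?\<psi> x = k * pi" "\<theta> + n * pi / 2 - ?\<psi> y = l * pi"
    unfolding poly_T_eq_0_iff[OF ctx] sin_zero_iff_int2 by blast
  have "?\<psi> x < ?\<psi> y" using xy(1) by (rule arctan_sum_less[OF ctx])
  then have "l * pi < k * pi" using kl by linarith
  then have "real_of_int (l + 1) \<le> k" by simp
  then have "(l + 1) * pi \<le> k * pi" by (intro mult_right_mono) auto
  then have "?\<psi> x + pi \<le> ?\<psi> y" using kl by (simp add: algebra_simps)
  moreover have "?\<psi> x \<le> ?\<psi> x + pi" by simp
  \<comment> \<open>At distinct roots \<psi> differs by a positive multiple of \<pi>. Cutting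
    \<open>y\<close> back to \<open>y1\<close> makes the growth exactly \<pi> even for
    non-consecutive roots.\<close>
  ultimately obtain y1 where y1: "x \<le> y1" "y1 \<le> y" "?\<psi> y1 = ?\<psi> x + pi"
    using IVT'[of ?\<psi> x "?\<psi> x + pi" y] xy(1) arctan_sum_continuous[OF ctx] by auto
  then have "x < y1" by (cases "x = y1") auto
  \<comment> \<open>\<open>j\<close> rounds (\<psi>(x) + \<psi>(y1)) / (2\<pi>) to a nearest
    integer.\<close>
  define j where "j = \<lfloor>(?\<psi> x + ?\<psi> y1 + pi) / (2 * pi)\<rfloor>"
  define u where "u = ?\<psi> x + ?\<psi> y1 - 2 * pi * j"
  have u: "\<bar>u\<bar> \<le> pi"
    using floor_divide_lower[of "2 * pi" "?\<psi> x + ?\<psi> y1 + pi"]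
      floor_divide_upper[of "2 * pi" "?\<psi> x + ?\<psi> y1 + pi"]
    by (simp add: u_def j_def abs_le_iff algebra_simps)
  have gap: "2 * h * sin (pi / n) \<le> (y1 - x) * (cos (pi / n) + cos (u / n))"
    using y1 by (intro arctan_sum_shift_gap[where a = a and j = j, OF h n \<open>x < y1\<close> _ u])
      (simp_all add: u_def arctan_sum_def)
  \<comment> \<open>Chosen so that n s = \<psi>(x) - j\<pi> and n t = \<psi>(y1) - j\<pi>: the
    phases of x^n at h tan s and h tan t agree with those of \<open>P\<close> at \<open>x\<close>
    and \<open>y1\<close> up to multiples of \<pi>.\<close>
  define s where "s = (u - pi) / (2 * n)"
  define t where "t = (u + pi) / (2 * n)"
  have half: "u / 2 = ?\<psi> x - j * pi + pi / 2" using y1 by (simp add: u_def field_simps)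
  have ns: "n * s = (u - pi) / 2" "n * t = (u + pi) / 2" using n by (simp_all add: s_def t_def)
  have roots: "sin (\<theta> + n * pi / 2 - n * s) = 0" "sin (\<theta> + n * pi / 2 - n * t) = 0"
  proof -
    have "\<theta> + n * pi / 2 - n * s = real_of_int (k + j) * pi"
      "\<theta> + n * pi / 2 - n * t = real_of_int (k + j - 1) * pi"
      using kl half unfolding ns by (simp_all add: algebra_simps add_divide_distrib diff_divide_distrib)
    then show "sin (\<theta> + n * pi / 2 - n * s) = 0" "sin (\<theta> + n * pi / 2 - n * t) = 0"
      unfolding sin_zero_iff_int2 by blast+
  qed
  have st: "\<bar>s\<bar> < pi / 2" "\<bar>t\<bar> < pi / 2"
  proof -
    \<comment> \<open>Only n = 2 admits \<bar>r\<bar> = \<pi>/2, and then the phase is \<theta> or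
      \<theta> + 2\<pi>, forcing the excluded sin \<theta> = 0.\<close>
    have *: "\<bar>r\<bar> < pi / 2"
      if r: "\<bar>n * r\<bar> \<le> pi" "sin (\<theta> + n * pi / 2 - n * r) = 0" for r :: real
    proof (rule ccontr)
      assume "\<not> \<bar>r\<bar> < pi / 2"
      then have "n * (pi / 2) \<le> n * \<bar>r\<bar>" by (intro mult_left_mono) auto
      also have "\<dots> \<le> pi" using r(1) by (simp add: abs_mult)
      finally have "n = 2" using n by simp
      with \<open>\<not> \<bar>r\<bar> < pi / 2\<close> r(1) have "r = pi / 2 \<or> r = - (pi / 2)" by (auto simp: abs_if split: if_splits)
      then have "\<theta> + n * pi / 2 - n * r = \<theta> \<or> \<theta> + n * pi / 2 - n * r = \<theta> + 2 * pi"
        using \<open>n = 2\<close> by auto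
      then have "sin \<theta> = 0" using r(2) sin_periodic by metis
      with n3 \<open>n = 2\<close> show False by simp
    qed
    have "\<bar>n * s\<bar> \<le> pi" "\<bar>n * t\<bar> \<le> pi" unfolding ns using u by (auto simp: abs_le_iff)
    then show "\<bar>s\<bar> < pi / 2" "\<bar>t\<bar> < pi / 2" using * roots by blast+
  qed
  have "s < t" using n by (simp add: s_def t_def divide_strict_right_mono)
  then have tan: "tan s < tan t" using st by (intro tan_monotone) auto
  have cos: "0 < cos s" "0 < cos t" using st by (auto intro!: cos_gt_zero_pi)
  have diff: "pi / n = t - s" and sum: "u / n = t + s" using n by (simp_all add: s_def t_def field_simps)
  \<comment> \<open>This product is twice the denominator in tan t - tan s = sin (t - s) / (cos s
    cos t), which turns \<open>gap\<close> into the desired bound.\<close>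
  have cc: "cos (pi / n) + cos (u / n) = 2 * (cos s * cos t)"
    unfolding diff sum cos_diff cos_add by simp
  have "h * tan t - h * tan s = h * sin (pi / n) / (cos s * cos t)"
    unfolding diff sin_diff using cos by (simp add: tan_def field_simps)
  moreover have "h * sin (pi / n) / (cos s * cos t) \<le> y1 - x"
    using gap cos unfolding cc by (simp add: field_simps)
  ultimately have "h * tan t - h * tan s \<le> y - x" using y1 by linarith
  then show ?thesis
    using tan h poly_T_monom_eq_0[OF h n st(1) roots(1)] poly_T_monom_eq_0[OF h n st(2) roots(2)]
    by (intro exI[of _ "h * tan s"] exI[of _ "h * tan t"]) auto
qed

text \<open>A pair attaining the mesh of T(P) yields roots of T(x^n) no farther apart. The
  disjunction covers both cases of the theorem and keeps the degrees of both images at least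
  2.\<close>

lemma mesh_T_monom_le:
  assumes "hyperbolic P" "degree P \<ge> 2" "degree P \<ge> 3 \<or> sin \<theta> \<noteq> 0" "h > 0"
  shows "mesh (T \<theta> h (monom 1 (degree P))) \<le> mesh (T \<theta> h P)"
proof -
  have "P \<noteq> 0" using assms by auto
  then obtain c a where P: "P = smult c (\<Prod>i<degree P. [:- a i, 1:])" "c \<noteq> 0"
    using hyperbolic_factorization assms by blast
  note P_simple = T_neq_0[OF P assms(4,2)] T_simple_roots[OF P assms(4,2,3)]
  note monom_simple = T_neq_0[OF monom_eq_prod one_neq_zero assms(4,2)]
    T_simple_roots[OF monom_eq_prod one_neq_zero assms(4,2,3)]
  obtain x y where xy: "x < y" "poly (T \<theta> h P) x = 0" "poly (T \<theta> h P) y = 0" "mesh (T \<theta> h P) = y - x"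
    using mesh_simple_roots(1)[OF P_simple] by blast
  from T_root_gap[OF P assms(4,2,3) xy(1-3)]
  obtain x' y' where xy': "x' < y'" "poly (T \<theta> h (monom 1 (degree P))) x' = 0"
    "poly (T \<theta> h (monom 1 (degree P))) y' = 0" "y' - x' \<le> y - x" by blast
  have "mesh (T \<theta> h (monom 1 (degree P))) \<le> y' - x'"
    using mesh_simple_roots(2)[OF monom_simple xy'(1-3)] .
  then show ?thesis using xy xy' by linarith
qed

theorem theorem1p6:
  shows "(\<forall>(P::real poly) (n::nat) (\<theta>::real) (h::real).
            hyperbolic P \<longrightarrow> degree P = n \<longrightarrow> n \<ge> 2 \<longrightarrow> sin \<theta> \<noteq> 0 \<longrightarrow> h > 0 \<longrightarrow>
              mesh (T \<theta> h P) \<ge> mesh (T \<theta> h (monom 1 n)))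
       \<and> (\<forall>(P::real poly) (n::nat) (\<theta>::real) (h::real).
            hyperbolic P \<longrightarrow> degree P = n \<longrightarrow> n \<ge> 3 \<longrightarrow> sin \<theta> = 0 \<longrightarrow> h > 0 \<longrightarrow>
              mesh (T \<theta> h P) \<ge> mesh (T \<theta> h (monom 1 n)))"
  using mesh_T_monom_le by auto

end
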